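(* Let $H$ and $K$ be Archimedean, cancellative, duo monoids. Then every semigroup isomorphism $f\colon \mathfrak{I}_{\mathrm{fin}}(H)\to\mathfrak{I}_{\mathrm{fin}}(K)$ restricts to an isomorphism from $\mathfrak{P}(H)$ to $\mathfrak{P}(K)$ (that is, $f[\mathfrak{P}(H)]=\mathfrak{P}(K)$). In particular, if $\mathfrak{I}_{\mathrm{fin}}(H)$ is isomorphic to $\mathfrak{I}_{\mathrm{fin}}(K)$, then $H_{\mathrm{red}}$ is isomorphic to $K_{\mathrm{red}}$.
   Context: Monoids are written multiplicatively; $H^\times$ is the group of units of a monoid $H$. For subsets $X,Y$ of $H$, $XY:=\{xy : x\in X,\ y\in Y\}$, and braces of singletons are omitted in such products (e.g. $HaH = H\{a\}H$). A monoid $H$ is: cancellative if $ax\ne ay$ and $xa\neq ya$ for all $a,x,y\in H$ with $x\ne y$; duo if $aH=Ha$ for every $a\in H$; Archimedean if, for all $a,b\in H$ such that $b$ is not a unit, there is an integer $k\ge 1$ with $b^k\in HaH$. An ideal of $H$ is a non-empty set $I\subseteq H$ with $IH\subseteq I$ and $HI\subseteq I$. The ideals of $H$ form a semigroup $\mathfrak{I}(H)$ under setwise multiplication. An ideal is finitely generated if it is of the form $HXH$ for some non-empty finite $X\subseteq H$, and principal if it is of the form $HxH$ with $x\in H$. $\mathfrak{I}_{\mathrm{fin}}(H)$ is the subsemigroup of $\mathfrak{I}(H)$ generated by the finitely generated ideals, and $\mathfrak{P}(H)$ is the subsemigroup of $\mathfrak{I}_{\mathrm{fin}}(H)$ generated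 by the principal ideals. Two elements $a,b\in H$ are associated if $HaH=HbH$. The reduced quotient $H_{\mathrm{red}}$ is the quotient of $H$ by the smallest semigroup congruence containing the relation of associatedness. "Isomorphism" means semigroup isomorphism. *)

theory Defs
  imports "HOL-Algebra.Divisibility"
begin

definition two_sided_gen :: "('a, 'm) monoid_scheme \<Rightarrow> 'a set \<Rightarrow> 'a set" where
  "two_sided_gen H X = carrier H <#>\<^bsub>H\<^esub> X <#>\<^bsub>H\<^esub> carrier H"

locale duo_monoid = monoid H for H (structure) +
  assumes duo: "a \<in> carrier H \<Longrightarrow> a <# carrier H = carrier H #> a"

locale archimedean_monoid = monoid H for H (structure) +
  assumes archimedean:
    "\<lbrakk>a \<in> carrier H; b \<in> carrier H; b \<notin> Units H\<rbrakk>
      \<Longrightarrow> \<exists>k::nat. k \<ge> 1 \<and> b [^] k \<in> two_sided_gen H {a}"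

definition monoid_ideal :: "('a, 'm) monoid_scheme \<Rightarrow> 'a set \<Rightarrow> bool" where
  "monoid_ideal H I \<longleftrightarrow> I \<noteq> {} \<and> I \<subseteq> carrier H \<and>
     I <#>\<^bsub>H\<^esub> carrier H \<subseteq> I \<and> carrier H <#>\<^bsub>H\<^esub> I \<subseteq> I"

definition fin_gen_ideals :: "('a, 'm) monoid_scheme \<Rightarrow> 'a set set" where
  "fin_gen_ideals H =
    {two_sided_gen H X | X. finite X \<and> X \<noteq> {} \<and> X \<subseteq> carrier H}"

definition principal_ideals :: "('a, 'm) monoid_scheme \<Rightarrow> 'a set set" where
  "principal_ideals H = {two_sided_gen H {x} | x. x \<in> carrier H}"

text \<open>The semigroups of ideals below are encoded as monoid records, because the
  library has no record of semigroups. Their identity element is the ideal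
  \<^term>\<open>carrier H\<close>; the predicates \<^const>\<open>iso\<close> and \<^const>\<open>is_iso\<close> do not refer to
  identity elements, so that they express semigroup isomorphism.\<close>

definition ideal_semigroup :: "('a, 'm) monoid_scheme \<Rightarrow> 'a set monoid" where
  "ideal_semigroup H =
    \<lparr>carrier = {I. monoid_ideal H I}, mult = set_mult H, one = carrier H\<rparr>"

inductive_set subsemigroup_gen :: "('a, 'm) monoid_scheme \<Rightarrow> 'a set \<Rightarrow> 'a set"
  for S :: "('a, 'm) monoid_scheme" and A :: "'a set" where
  incl: "a \<in> A \<Longrightarrow> a \<in> subsemigroup_gen S A"
| mult: "\<lbrakk>a \<in> subsemigroup_gen S A; b \<in> subsemigroup_gen S A\<rbrakk>
    \<Longrightarrow> a \<otimes>\<^bsub>S\<^esub> b \<in> subsemigroup_gen S A"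

definition ideal_semigroup_fin :: "('a, 'm) monoid_scheme \<Rightarrow> 'a set monoid" where
  "ideal_semigroup_fin H =
    (ideal_semigroup H)\<lparr>carrier := subsemigroup_gen (ideal_semigroup H) (fin_gen_ideals H)\<rparr>"

definition principal_semigroup :: "('a, 'm) monoid_scheme \<Rightarrow> 'a set monoid" where
  "principal_semigroup H =
    (ideal_semigroup_fin H)
      \<lparr>carrier := subsemigroup_gen (ideal_semigroup_fin H) (principal_ideals H)\<rparr>"

definition semigroup_congruence :: "('a, 'm) monoid_scheme \<Rightarrow> ('a \<times> 'a) set \<Rightarrow> bool" where
  "semigroup_congruence H R \<longleftrightarrow> equiv (carrier H) R \<and>
     (\<forall>a b c d. (a, b) \<in> R \<longrightarrow> (c, d) \<in> R \<longrightarrow> (a \<otimes>\<^bsub>H\<^esub> c, b \<otimes>\<^bsub>H\<^esub> d) \<in> R)"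

definition associatedness :: "('a, 'm) monoid_scheme \<Rightarrow> ('a \<times> 'a) set" where
  "associatedness H = {(a, b). a \<in> carrier H \<and> b \<in> carrier H \<and>
     two_sided_gen H {a} = two_sided_gen H {b}}"

definition red_congruence :: "('a, 'm) monoid_scheme \<Rightarrow> ('a \<times> 'a) set" where
  "red_congruence H = \<Inter> {R. semigroup_congruence H R \<and> associatedness H \<subseteq> R}"

text \<open>The setwise product of two congruence classes lies in a single class but need
  not be all of it; taking the image under the congruence yields the whole class.\<close>

definition reduced_quotient :: "('a, 'm) monoid_scheme \<Rightarrow> 'a set monoid" where
  "reduced_quotient H =
    \<lparr>carrier = carrier H // red_congruence H,
     mult = (\<lambda>A B. red_congruence H `` (A <#>\<^bsub>H\<^esub> B)),
     one = red_congruence H `` {\<one>\<^bsub>H\<^esub>}\<rparr>"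

context monoid
begin

lemma red_congruence: "semigroup_congruence G (red_congruence G)"
proof -
  let ?C = "{R. semigroup_congruence G R \<and> associatedness G \<subseteq> R}"
  have total: "carrier G \<times> carrier G \<in> ?C"
    by (auto simp: semigroup_congruence_def associatedness_def equiv_def refl_on_def
        sym_def trans_def)
  have "equiv (carrier G) (\<Inter> ?C)"
  proof (rule equivI)
    show "\<Inter> ?C \<subseteq> carrier G \<times> carrier G" using total by blast
    show "refl_on (carrier G) (\<Inter> ?C)"
      by (auto simp: semigroup_congruence_def equiv_def refl_on_def)
    show "sym (\<Inter> ?C)"
      by (rule symI) (auto simp: semigroup_congruence_def equiv_def dest: symD)
    show "trans (\<Inter> ?C)"
      by (rule transI) (auto simp: semigroup_congruence_def equiv_def dest: transD)
  qed
  then show ?thesis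
    unfolding red_congruence_def by (auto simp: semigroup_congruence_def)
qed

lemma reduced_quotient_mult_class:
  assumes a: "a \<in> carrier G" and b: "b \<in> carrier G"
  shows "red_congruence G `` {a} \<otimes>\<^bsub>reduced_quotient G\<^esub> red_congruence G `` {b}
    = red_congruence G `` {a \<otimes> b}"
proof -
  let ?R = "red_congruence G"
  have eq: "equiv (carrier G) ?R"
    and cong: "\<And>a b c d. \<lbrakk>(a, b) \<in> ?R; (c, d) \<in> ?R\<rbrakk> \<Longrightarrow> (a \<otimes> c, b \<otimes> d) \<in> ?R"
    using red_congruence by (auto simp: semigroup_congruence_def)
  have class_eq: "?R `` {x \<otimes> y} = ?R `` {a \<otimes> b}" if "x \<in> ?R `` {a}" "y \<in> ?R `` {b}" for x y
    using that cong[of a x b y] equiv_class_eq[OF eq] by auto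
  have "a \<in> ?R `` {a}" "b \<in> ?R `` {b}"
    using equiv_class_self[OF eq] a b by auto
  then have "?R `` (?R `` {a} <#> ?R `` {b}) = ?R `` {a \<otimes> b}"
    using class_eq unfolding set_mult_def by blast
  then show ?thesis
    by (simp add: reduced_quotient_def)
qed

lemma mem_set_mult: "x \<in> A <#> B \<longleftrightarrow> (\<exists>a\<in>A. \<exists>b\<in>B. x = a \<otimes> b)"
  by (auto simp: set_mult_def)

lemma set_mult_assoc_monoid:
  assumes "A \<subseteq> carrier G" "B \<subseteq> carrier G" "C \<subseteq> carrier G"
  shows "A <#> B <#> C = A <#> (B <#> C)"
proof -
  have "A <#> B <#> C = (\<Union>a\<in>A. \<Union>b\<in>B. \<Union>c\<in>C. {a \<otimes> b \<otimes> c})"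
    by (auto simp: set_mult_def)
  also have "\<dots> = (\<Union>a\<in>A. \<Union>b\<in>B. \<Union>c\<in>C. {a \<otimes> (b \<otimes> c)})"
    using assms by (intro SUP_cong refl) (auto simp: m_assoc subset_iff)
  also have "\<dots> = A <#> (B <#> C)"
    by (auto simp: set_mult_def)
  finally show ?thesis .
qed

lemma monoid_ideal_mult:
  assumes I: "monoid_ideal G I" and J: "monoid_ideal G J"
  shows "monoid_ideal G (I <#> J)"
proof -
  have sub: "I \<subseteq> carrier G" "J \<subseteq> carrier G" and ne: "I \<noteq> {}" "J \<noteq> {}"
    and JR: "J <#> carrier G \<subseteq> J" and IL: "carrier G <#> I \<subseteq> I"
    using I J by (auto simp: monoid_ideal_def)
  have "I <#> J <#> carrier G = I <#> (J <#> carrier G)"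
    "carrier G <#> (I <#> J) = carrier G <#> I <#> J"
    using sub by (simp_all add: set_mult_assoc_monoid)
  moreover have "I <#> (J <#> carrier G) \<subseteq> I <#> J" "carrier G <#> I <#> J \<subseteq> I <#> J"
    using JR IL by (simp_all add: mono_set_mult)
  moreover have "I <#> J \<noteq> {}"
    using ne by (auto simp: set_mult_def)
  ultimately show ?thesis
    using sub by (simp add: monoid_ideal_def set_mult_closed)
qed

lemma monoid_ideal_two_sided_gen:
  assumes X: "X \<subseteq> carrier G" "X \<noteq> {}"
  shows "monoid_ideal G (two_sided_gen G X)"
proof -
  let ?C = "carrier G"
  have CC: "?C <#> ?C = ?C"
  proof
    show "?C <#> ?C \<subseteq> ?C" by (auto simp: set_mult_def)
    show "?C \<subseteq> ?C <#> ?C" using mem_set_mult r_one one_closed by (metis subsetI)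
  qed
  have CX: "?C <#> X \<subseteq> ?C" using X by (simp add: set_mult_closed)
  have "?C <#> X <#> ?C <#> ?C = ?C <#> X <#> ?C"
    using set_mult_assoc_monoid[OF CX, of ?C ?C] CC by simp
  moreover have "?C <#> (?C <#> X <#> ?C) = ?C <#> X <#> ?C"
    using set_mult_assoc_monoid[of ?C "?C <#> X" ?C] set_mult_assoc_monoid[of ?C ?C X] CX CC X by simp
  moreover have "?C <#> X <#> ?C \<subseteq> ?C" using CX by (simp add: set_mult_closed)
  moreover have "?C <#> X <#> ?C \<noteq> {}" using X one_closed by (auto simp: set_mult_def)
  ultimately show ?thesis by (simp add: monoid_ideal_def two_sided_gen_def)
qed

lemma monoid_ideal_semigroup: "monoid (ideal_semigroup G)"
proof (rule monoidI, unfold ideal_semigroup_def, simp_all)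
  show "monoid_ideal G (carrier G)"
    by (auto simp: monoid_ideal_def set_mult_def)
next
  fix I J assume "monoid_ideal G I" "monoid_ideal G J"
  then show "monoid_ideal G (I <#> J)" by (rule monoid_ideal_mult)
next
  fix I J L assume "monoid_ideal G I" "monoid_ideal G J" "monoid_ideal G L"
  then show "I <#> J <#> L = I <#> (J <#> L)"
    by (simp add: monoid_ideal_def set_mult_assoc_monoid)
next
  fix I assume I: "monoid_ideal G I"
  then have sub: "I \<subseteq> carrier G" by (simp add: monoid_ideal_def)
  have "I \<subseteq> carrier G <#> I"
  proof
    fix x assume "x \<in> I"
    with sub have "x = \<one> \<otimes> x" by auto
    with \<open>x \<in> I\<close> show "x \<in> carrier G <#> I" unfolding mem_set_mult by blast
  qed
  with I show "carrier G <#> I = I" by (auto simp: monoid_ideal_def)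
  have "I \<subseteq> I <#> carrier G"
  proof
    fix x assume "x \<in> I"
    with sub have "x = x \<otimes> \<one>" by auto
    with \<open>x \<in> I\<close> show "x \<in> I <#> carrier G" unfolding mem_set_mult by blast
  qed
  with I show "I <#> carrier G = I" by (auto simp: monoid_ideal_def)
qed

end

end

theory Submission
  imports Defs
begin

text \<open>
  The principal ideals are exactly the left cancellable elements of the semigroup of finitely
  generated ideals, so any isomorphism preserves them. For the non-trivial inclusion, let \<open>X\<close> be
  a minimal generating set of a non-principal ideal. In the group of quotients, the fractional
  ideal \<open>T\<close> generated by all \<open>x\<^sup>-\<^sup>1 y\<close> with \<open>x \<noteq> y\<close> in \<open>X\<close> does not contain \<open>1\<close>, by minimality,
  but \<open>X T = X (T \<union> {1})\<close> as \<open>y = x (x\<^sup>-\<^sup>1 y)\<close>. Multiplying by a common multiple \<open>d\<close> of \<open>X\<close> clears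
  the denominators. The second claim follows because associatedness is already a congruence in
  a duo monoid, so that the reduced quotient is isomorphic to the semigroup of principal ideals.
\<close>

section \<open>Cancellable elements and isomorphisms of semigroups\<close>

definition left_cancellable :: "('a, 'm) monoid_scheme \<Rightarrow> 'a set" where
  "left_cancellable S = {a \<in> carrier S. \<forall>b\<in>carrier S. \<forall>c\<in>carrier S.
     a \<otimes>\<^bsub>S\<^esub> b = a \<otimes>\<^bsub>S\<^esub> c \<longrightarrow> b = c}"

text \<open>Left cancellability is expressed by multiplication and equality alone, so an isomorphism
  both preserves and reflects it. The assumption \<open>closed\<close> keeps products in the set on
  which \<open>h\<close> is injective.\<close>

lemma iso_image_left_cancellable:
  assumes h: "h \<in> iso S T"
    and closed: "\<And>a b. a \<in> carrier S \<Longrightarrow> b \<in> carrier S \<Longrightarrow> a \<otimes>\<^bsub>S\<^esub> b \<in> carrier S"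
  shows "h ` left_cancellable S = left_cancellable T"
proof -
  have mult: "h (a \<otimes>\<^bsub>S\<^esub> b) = h a \<otimes>\<^bsub>T\<^esub> h b" if "a \<in> carrier S" "b \<in> carrier S" for a b
    using h that by (simp add: iso_def hom_def)
  have inj: "inj_on h (carrier S)" and surj: "h ` carrier S = carrier T"
    using h by (auto simp: iso_def bij_betw_def)
  have "h a \<in> left_cancellable T \<longleftrightarrow> a \<in> left_cancellable S" if a: "a \<in> carrier S" for a
  proof -
    have "h a \<otimes>\<^bsub>T\<^esub> h b = h a \<otimes>\<^bsub>T\<^esub> h c \<longleftrightarrow> a \<otimes>\<^bsub>S\<^esub> b = a \<otimes>\<^bsub>S\<^esub> c" "h b = h c \<longleftrightarrow> b = c"
      if "b \<in> carrier S" "c \<in> carrier S" for b c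
      using that a closed inj by (auto simp: mult[symmetric] inj_on_eq_iff)
    then show ?thesis
      using a unfolding left_cancellable_def surj[symmetric] by auto
  qed
  moreover have "left_cancellable S \<subseteq> carrier S" "left_cancellable T \<subseteq> h ` carrier S"
    by (auto simp: left_cancellable_def surj)
  ultimately show ?thesis
    by blast
qed

text \<open>The records here stand for semigroups, so the inverse map is treated under closure
  alone: \<open>closed\<close> is what allows \<open>?g\<close> to undo \<open>h\<close> on a
  product.\<close>

lemma is_iso_sym:
  assumes "S \<cong> T"
    and closed: "\<And>a b. a \<in> carrier S \<Longrightarrow> b \<in> carrier S \<Longrightarrow> a \<otimes>\<^bsub>S\<^esub> b \<in> carrier S"
  shows "T \<cong> S"
proof -
  obtain h where h: "h \<in> hom S T" "bij_betw h (carrier S) (carrier T)"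
    using assms(1) by (auto simp: is_iso_def iso_def)
  let ?g = "inv_into (carrier S) h"
  have g: "bij_betw ?g (carrier T) (carrier S)"
    using h(2) by (rule bij_betw_inv_into)
  have "?g (x \<otimes>\<^bsub>T\<^esub> y) = ?g x \<otimes>\<^bsub>S\<^esub> ?g y" if x: "x \<in> carrier T" and y: "y \<in> carrier T" for x y
  proof -
    have gxy: "?g x \<in> carrier S" "?g y \<in> carrier S"
      using g x y by (auto dest: bij_betwE)
    have "h (?g x \<otimes>\<^bsub>S\<^esub> ?g y) = h (?g x) \<otimes>\<^bsub>T\<^esub> h (?g y)"
      using gxy h(1) by (simp add: hom_def)
    also have "\<dots> = x \<otimes>\<^bsub>T\<^esub> y"
      using h(2) x y by (simp add: bij_betw_inv_into_right)
    finally show ?thesis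
      using bij_betw_inv_into_left[OF h(2) closed[OF gxy]] by simp
  qed
  then have "?g \<in> iso T S"
    using g by (auto simp: iso_def hom_def dest: bij_betwE)
  then show ?thesis by (auto simp: is_iso_def)
qed

text \<open>Serves to identify the generated semigroups of ideals with their sets of
  generators.\<close>

lemma subsemigroup_gen_closed:
  assumes "\<And>a b. a \<in> A \<Longrightarrow> b \<in> A \<Longrightarrow> a \<otimes>\<^bsub>S\<^esub> b \<in> A"
  shows "subsemigroup_gen S A = A"
proof
  show "subsemigroup_gen S A \<subseteq> A"
  proof
    fix x assume "x \<in> subsemigroup_gen S A"
    then show "x \<in> A" by induction (auto intro: assms)
  qed
qed (auto intro: subsemigroup_gen.incl)

section \<open>Ideals of a duo monoid\<close>

context duo_monoid
begin

lemma commute_left: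
  assumes "a \<in> carrier H" "h \<in> carrier H"
  obtains h' where "h' \<in> carrier H" "h \<otimes> a = a \<otimes> h'"
  using duo[OF assms(1)] assms unfolding l_coset_def r_coset_def by blast

lemma commute_right:
  assumes "a \<in> carrier H" "h \<in> carrier H"
  obtains h' where "h' \<in> carrier H" "a \<otimes> h = h' \<otimes> a"
  using duo[OF assms(1)] assms unfolding l_coset_def r_coset_def by blast

text \<open>The duo property moves a left multiplier to the right of the generator. Membership thus
  means being divisible, in the sense of \<open>divides\<close>, by some element of
  \<open>X\<close>.\<close>

lemma mem_two_sided_gen:
  assumes X: "X \<subseteq> carrier H"
  shows "y \<in> two_sided_gen H X \<longleftrightarrow> (\<exists>x\<in>X. \<exists>h\<in>carrier H. y = x \<otimes> h)"
proof
  assume "y \<in> two_sided_gen H X"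
  then obtain g x h where *: "g \<in> carrier H" "x \<in> X" "h \<in> carrier H" "y = g \<otimes> x \<otimes> h"
    by (auto simp: two_sided_gen_def mem_set_mult)
  with X obtain g' where "g' \<in> carrier H" "g \<otimes> x = x \<otimes> g'"
    using commute_left by blast
  moreover have "x \<in> carrier H" using * X by blast
  ultimately have "y = x \<otimes> (g' \<otimes> h)" "g' \<otimes> h \<in> carrier H"
    using * m_assoc by auto
  with * show "\<exists>x\<in>X. \<exists>h\<in>carrier H. y = x \<otimes> h" by blast
next
  assume "\<exists>x\<in>X. \<exists>h\<in>carrier H. y = x \<otimes> h"
  then obtain x h where *: "x \<in> X" "h \<in> carrier H" "y = x \<otimes> h" by blast
  with X have "y = \<one> \<otimes> x \<otimes> h" by auto
  with * show "y \<in> two_sided_gen H X"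
    unfolding two_sided_gen_def set_mult_def by blast
qed

lemma subset_two_sided_gen:
  assumes "X \<subseteq> carrier H"
  shows "X \<subseteq> two_sided_gen H X"
proof
  fix x assume "x \<in> X"
  with assms have "x = x \<otimes> \<one>" by auto
  with \<open>x \<in> X\<close> show "x \<in> two_sided_gen H X"
    unfolding mem_two_sided_gen[OF assms] by blast
qed

lemma two_sided_gen_least:
  assumes Y: "Y \<subseteq> two_sided_gen H Z" and Z: "Z \<subseteq> carrier H"
  shows "two_sided_gen H Y \<subseteq> two_sided_gen H Z"
proof
  have Y': "Y \<subseteq> carrier H"
    using Y Z by (auto simp: mem_two_sided_gen subset_iff)
  fix y assume "y \<in> two_sided_gen H Y"
  then obtain x h where *: "x \<in> Y" "h \<in> carrier H" "y = x \<otimes> h"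
    unfolding mem_two_sided_gen[OF Y'] by blast
  obtain z g where z: "z \<in> Z" "g \<in> carrier H" "x = z \<otimes> g"
    using * Y by (metis Z mem_two_sided_gen subsetD)
  have "y = z \<otimes> (g \<otimes> h)" "g \<otimes> h \<in> carrier H"
    using * z Z by (auto simp: m_assoc subset_iff)
  with z show "y \<in> two_sided_gen H Z"
    unfolding mem_two_sided_gen[OF Z] by blast
qed

text \<open>The multiplier \<open>g\<close> between the two generators is moved past
  \<open>y\<close>, so the products of generators suffice. This reduces computations with ideals to
  computations with finite sets.\<close>

lemma two_sided_gen_mult:
  assumes X: "X \<subseteq> carrier H" and Y: "Y \<subseteq> carrier H"
  shows "two_sided_gen H X <#> two_sided_gen H Y = two_sided_gen H (X <#> Y)"
proof -
  have XY: "X <#> Y \<subseteq> carrier H"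
    using X Y by (simp add: set_mult_closed)
  show ?thesis
  proof (intro equalityI subsetI)
    fix z assume "z \<in> two_sided_gen H X <#> two_sided_gen H Y"
    then obtain x g y h where *: "x \<in> X" "g \<in> carrier H" "y \<in> Y" "h \<in> carrier H"
      "z = (x \<otimes> g) \<otimes> (y \<otimes> h)"
      by (auto simp: mem_set_mult mem_two_sided_gen[OF X] mem_two_sided_gen[OF Y])
    with Y obtain g' where g': "g' \<in> carrier H" "g \<otimes> y = y \<otimes> g'"
      using commute_left by blast
    have "x \<in> carrier H" "y \<in> carrier H" using * X Y by auto
    then have "z = x \<otimes> (g \<otimes> y) \<otimes> h"
      using * by (simp add: m_assoc)
    also have "\<dots> = (x \<otimes> y) \<otimes> (g' \<otimes> h)"
      using * g' \<open>x \<in> carrier H\<close> \<open>y \<in> carrier H\<close> by (simp add: m_assoc)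
    finally have "z = (x \<otimes> y) \<otimes> (g' \<otimes> h)" .
    moreover have "x \<otimes> y \<in> X <#> Y" "g' \<otimes> h \<in> carrier H"
      using * g' by (auto simp: mem_set_mult)
    ultimately show "z \<in> two_sided_gen H (X <#> Y)"
      unfolding mem_two_sided_gen[OF XY] by blast
  next
    fix z assume "z \<in> two_sided_gen H (X <#> Y)"
    then obtain x y h where *: "x \<in> X" "y \<in> Y" "h \<in> carrier H" "z = x \<otimes> y \<otimes> h"
      by (auto simp: mem_two_sided_gen[OF XY] mem_set_mult)
    then have "z = x \<otimes> (y \<otimes> h)"
      using X Y by (auto simp: m_assoc subset_iff)
    moreover have "x \<in> two_sided_gen H X" "y \<otimes> h \<in> two_sided_gen H Y"
      using * subset_two_sided_gen[OF X] mem_two_sided_gen[OF Y] by auto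
    ultimately show "z \<in> two_sided_gen H X <#> two_sided_gen H Y"
      unfolding mem_set_mult by blast
  qed
qed

lemma two_sided_gen_singleton_mult:
  "a \<in> carrier H \<Longrightarrow> b \<in> carrier H \<Longrightarrow>
    two_sided_gen H {a} <#> two_sided_gen H {b} = two_sided_gen H {a \<otimes> b}"
  by (simp add: two_sided_gen_mult) (simp add: set_mult_def)

text \<open>A product of two finitely generated ideals is generated by the finitely many products of
  generators, so generating a subsemigroup adds nothing new.\<close>

lemma ideal_semigroup_fin_simps:
  "carrier (ideal_semigroup_fin H) = fin_gen_ideals H"
  "mult (ideal_semigroup_fin H) = set_mult H"
proof -
  have "A <#> B \<in> fin_gen_ideals H" if "A \<in> fin_gen_ideals H" "B \<in> fin_gen_ideals H" for A B
  proof -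
    obtain X where X: "finite X" "X \<noteq> {}" "X \<subseteq> carrier H" "A = two_sided_gen H X"
      using \<open>A \<in> _\<close> by (auto simp: fin_gen_ideals_def)
    obtain Y where Y: "finite Y" "Y \<noteq> {}" "Y \<subseteq> carrier H" "B = two_sided_gen H Y"
      using \<open>B \<in> _\<close> by (auto simp: fin_gen_ideals_def)
    have "A <#> B = two_sided_gen H (X <#> Y)" "X <#> Y \<subseteq> carrier H"
      using X Y by (simp_all add: two_sided_gen_mult set_mult_closed)
    moreover have "finite (X <#> Y)" "X <#> Y \<noteq> {}"
      using X Y by (auto simp: set_mult_def)
    ultimately show ?thesis unfolding fin_gen_ideals_def by blast
  qed
  then show "carrier (ideal_semigroup_fin H) = fin_gen_ideals H"
    by (simp add: ideal_semigroup_fin_def ideal_semigroup_def subsemigroup_gen_closed)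
qed (simp add: ideal_semigroup_fin_def ideal_semigroup_def)

lemma principal_semigroup_simps:
  "carrier (principal_semigroup H) = principal_ideals H"
  "mult (principal_semigroup H) = set_mult H"
proof -
  have "A <#> B \<in> principal_ideals H" if "A \<in> principal_ideals H" "B \<in> principal_ideals H" for A B
    using that two_sided_gen_singleton_mult unfolding principal_ideals_def by blast
  then show "carrier (principal_semigroup H) = principal_ideals H"
    by (simp add: principal_semigroup_def ideal_semigroup_fin_simps subsemigroup_gen_closed)
qed (simp add: principal_semigroup_def ideal_semigroup_fin_simps)

lemma ideal_semigroup_fin_closed:
  "A \<in> carrier (ideal_semigroup_fin H) \<Longrightarrow> B \<in> carrier (ideal_semigroup_fin H) \<Longrightarrow>
    A \<otimes>\<^bsub>ideal_semigroup_fin H\<^esub> B \<in> carrier (ideal_semigroup_fin H)"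
  by (simp add: ideal_semigroup_fin_def subsemigroup_gen.mult[of _ "ideal_semigroup H", simplified])

lemma principal_semigroup_closed:
  "A \<in> carrier (principal_semigroup H) \<Longrightarrow> B \<in> carrier (principal_semigroup H) \<Longrightarrow>
    A \<otimes>\<^bsub>principal_semigroup H\<^esub> B \<in> carrier (principal_semigroup H)"
  by (simp add: principal_semigroup_def subsemigroup_gen.mult)

text \<open>Supplies the common denominator that lets the main argument stay inside the monoid
  instead of its group of quotients.\<close>

lemma finite_common_multiple:
  assumes "finite X" "X \<subseteq> carrier H"
  obtains d where "d \<in> carrier H" "\<And>x. x \<in> X \<Longrightarrow> x divides d"
proof -
  from assms have "\<exists>d\<in>carrier H. \<forall>x\<in>X. x divides d"
  proof (induction X)
    case (insert x X)
    then obtain d where d: "d \<in> carrier H" "\<forall>y\<in>X. y divides d" by auto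
    have x: "x \<in> carrier H" using insert by auto
    have "y divides x \<otimes> d" if "y \<in> X" for y
    proof -
      have y: "y \<in> carrier H" using that insert by auto
      obtain c where c: "c \<in> carrier H" "d = y \<otimes> c"
        using d(2)[rule_format, OF \<open>y \<in> X\<close>] by (rule dividesE)
      \<comment> \<open>Moving \<open>y\<close> to the front gives \<open>x \<otimes> d = x
        \<otimes> y \<otimes> c = y \<otimes> x' \<otimes> c\<close>, so the new multiple
        \<open>x \<otimes> d\<close> keeps the old divisors.\<close>
      obtain x' where "x' \<in> carrier H" "x \<otimes> y = y \<otimes> x'"
        using commute_left[OF y x] .
      with c x y have "x \<otimes> d = y \<otimes> (x' \<otimes> c)" "x' \<otimes> c \<in> carrier H"
        by (metis m_assoc, simp)
      then show ?thesis unfolding factor_def by blast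
    qed
    with d x show ?case
      by (intro bexI[of _ "x \<otimes> d"]) (auto simp: factor_def)
  qed auto
  with that show ?thesis by blast
qed

section \<open>The reduced quotient as a semigroup of principal ideals\<close>

text \<open>Compatibility with multiplication holds because the principal ideal of a product is the
  product of the principal ideals.\<close>

lemma associatedness_congruence: "semigroup_congruence H (associatedness H)"
  unfolding semigroup_congruence_def
proof (intro conjI allI impI)
  show "equiv (carrier H) (associatedness H)"
    by (rule equivI) (auto simp: associatedness_def refl_on_def sym_def trans_def)
  fix a b c d
  assume "(a, b) \<in> associatedness H" "(c, d) \<in> associatedness H"
  then show "(a \<otimes> c, b \<otimes> d) \<in> associatedness H"
    by (auto simp: associatedness_def simp flip: two_sided_gen_singleton_mult)
qed

lemma red_congruence_eq_associatedness: "red_congruence H = associatedness H"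
  using associatedness_congruence unfolding red_congruence_def by blast

lemma principal_semigroup_iso_reduced_quotient: "principal_semigroup H \<cong> reduced_quotient H"
proof -
  let ?R = "red_congruence H"
  \<comment> \<open>The value \<open>h A\<close> collects all generators of \<open>A\<close>, which
    form one class of associated elements; no generator has to be chosen.\<close>
  define h where "h A = {a \<in> carrier H. two_sided_gen H {a} = A}" for A
  have h: "h (two_sided_gen H {a}) = ?R `` {a}" if "a \<in> carrier H" for a
    using that by (auto simp: h_def red_congruence_eq_associatedness associatedness_def)
  have "h \<in> hom (principal_semigroup H) (reduced_quotient H)"
    unfolding hom_def principal_semigroup_simps
  proof (intro CollectI conjI funcsetI ballI)
    fix A assume "A \<in> principal_ideals H"
    then show "h A \<in> carrier (reduced_quotient H)"
      by (auto simp: principal_ideals_def h reduced_quotient_def quotientI)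
  next
    fix A B assume "A \<in> principal_ideals H" "B \<in> principal_ideals H"
    then show "h (A <#> B) = h A \<otimes>\<^bsub>reduced_quotient H\<^esub> h B"
      by (auto simp: principal_ideals_def two_sided_gen_singleton_mult h
          reduced_quotient_mult_class)
  qed
  moreover have "bij_betw h (principal_ideals H) (carrier (reduced_quotient H))"
    unfolding bij_betw_def
  proof
    show "inj_on h (principal_ideals H)"
      by (rule inj_onI) (auto simp: principal_ideals_def h_def)
    have "principal_ideals H = (\<lambda>a. two_sided_gen H {a}) ` carrier H"
      by (auto simp: principal_ideals_def)
    then show "h ` principal_ideals H = carrier (reduced_quotient H)"
      by (auto simp: image_image h reduced_quotient_def quotient_def)
  qed
  ultimately show ?thesis
    by (auto simp: is_iso_def iso_def principal_semigroup_simps)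
qed

end

section \<open>Principal ideals as the left cancellable elements\<close>

locale cancel_duo_monoid = monoid_cancel H + duo_monoid H for H (structure)
begin

text \<open>The factor \<open>B\<close> is recovered from \<open>A <#> B\<close> as the set of all
  \<open>y\<close> in the monoid with \<open>a \<otimes> y\<close> in the product, because
  \<open>a \<otimes> y = a \<otimes> x \<otimes> h\<close> cancels to
  \<open>y = x \<otimes> h\<close>.\<close>

lemma principal_left_cancellable:
  assumes "A \<in> principal_ideals H"
  shows "A \<in> left_cancellable (ideal_semigroup_fin H)"
proof -
  obtain a where a: "a \<in> carrier H" "A = two_sided_gen H {a}"
    using assms by (auto simp: principal_ideals_def)
  have *: "a \<otimes> y \<in> A <#> two_sided_gen H Y \<longleftrightarrow> y \<in> two_sided_gen H Y"
    if y: "y \<in> carrier H" and Y: "Y \<subseteq> carrier H" for y Y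
  proof -
    have aY: "{a} <#> Y \<subseteq> carrier H" using a Y by (simp add: set_mult_closed)
    have "a \<otimes> y \<in> A <#> two_sided_gen H Y \<longleftrightarrow> (\<exists>x\<in>Y. \<exists>h\<in>carrier H. a \<otimes> y = a \<otimes> x \<otimes> h)"
      using a Y by (simp add: two_sided_gen_mult mem_two_sided_gen[OF aY])
        (auto simp: set_mult_def)
    also have "\<dots> \<longleftrightarrow> (\<exists>x\<in>Y. \<exists>h\<in>carrier H. y = x \<otimes> h)"
      using a y Y by (intro bex_cong refl) (auto simp: m_assoc subset_iff dest: l_cancel)
    finally show ?thesis using mem_two_sided_gen[OF Y] by simp
  qed
  have "B = C" if "B \<in> fin_gen_ideals H" "C \<in> fin_gen_ideals H" "A <#> B = A <#> C" for B C
  proof -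
    have "\<exists>Y \<subseteq> carrier H. B = two_sided_gen H Y" "\<exists>Y \<subseteq> carrier H. C = two_sided_gen H Y"
      using that by (auto simp: fin_gen_ideals_def)
    moreover from this have "B \<subseteq> carrier H" "C \<subseteq> carrier H"
      by (auto simp: mem_two_sided_gen subset_iff)
    ultimately show ?thesis using * that(3) by (metis subsetD subsetI subset_antisym)
  qed
  moreover have "A \<in> fin_gen_ideals H"
    using a unfolding fin_gen_ideals_def by blast
  ultimately show ?thesis
    by (simp add: left_cancellable_def ideal_semigroup_fin_simps)
qed

text \<open>The antichain condition expresses that no generator is redundant. The ideals generated
  by \<open>T\<close> and by \<open>insert d T\<close> have the same product with the ideal of
  \<open>X\<close>, yet their equality would make one generator divide another.\<close>

lemma antichain_not_left_cancellable:
  assumes X: "finite X" "X \<subseteq> carrier H" "x1 \<in> X" "x2 \<in> X" "x1 \<noteq> x2"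
    and antichain: "\<And>x y. x \<in> X \<Longrightarrow> y \<in> X \<Longrightarrow> y divides x \<Longrightarrow> x = y"
  shows "two_sided_gen H X \<notin> left_cancellable (ideal_semigroup_fin H)"
proof
  assume lc: "two_sided_gen H X \<in> left_cancellable (ideal_semigroup_fin H)"
  obtain d where d: "d \<in> carrier H" "\<And>x. x \<in> X \<Longrightarrow> x divides d"
    using finite_common_multiple[OF X(1,2)] by blast
  \<comment> \<open>The witness \<open>t\<close> stands for the fraction \<open>x^-1 y d\<close>; it
    lies in the monoid because \<open>x\<close> divides \<open>d\<close> and can be moved past
    \<open>y\<close>.\<close>
  have "\<exists>t\<in>carrier H. x \<otimes> t = y \<otimes> d" if "x \<in> X" "y \<in> X" for x y
  proof -
    have xy: "x \<in> carrier H" "y \<in> carrier H" using that X by auto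
    obtain c where c: "c \<in> carrier H" "d = x \<otimes> c"
      using d(2)[OF \<open>x \<in> X\<close>] by (rule dividesE)
    obtain y' where y': "y' \<in> carrier H" "y \<otimes> x = x \<otimes> y'"
      using commute_left[OF xy] .
    have "x \<otimes> (y' \<otimes> c) = y \<otimes> d" "y' \<otimes> c \<in> carrier H"
      using c y' xy by (simp_all flip: m_assoc)
    then show ?thesis by blast
  qed
  then obtain t where t: "\<And>x y. x \<in> X \<Longrightarrow> y \<in> X \<Longrightarrow> t x y \<in> carrier H \<and> x \<otimes> t x y = y \<otimes> d"
    by metis
  \<comment> \<open>These are the generators \<open>x^-1 y\<close> of the fractional ideal,
    multiplied by \<open>d\<close>, so \<open>d\<close> now plays the role of 1. Diagonal pairs are
    left out because \<open>t x x\<close> would be \<open>d\<close> itself.\<close>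
  define T where "T = (\<lambda>(x, y). t x y) ` {(x, y) \<in> X \<times> X. x \<noteq> y}"
  have T: "finite T" "T \<subseteq> carrier H" "T \<noteq> {}"
  proof -
    show "finite T"
      unfolding T_def using X(1) by (intro finite_imageI) (auto intro: finite_subset[of _ "X \<times> X"])
    show "T \<subseteq> carrier H"
      using t by (auto simp: T_def)
    have "t x1 x2 \<in> T"
      using X by (auto simp: T_def)
    then show "T \<noteq> {}" by blast
  qed
  have XT: "X <#> T \<subseteq> carrier H"
    using X T by (simp add: set_mult_closed)
  have "X <#> insert d T \<subseteq> two_sided_gen H (X <#> T)"
  proof
    fix z assume "z \<in> X <#> insert d T"
    then obtain x s where *: "x \<in> X" "s = d \<or> s \<in> T" "z = x \<otimes> s"
      unfolding mem_set_mult by blast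
    have "z \<in> X <#> T"
    proof (cases "s \<in> T")
      case False
      \<comment> \<open>The only products to be checked are \<open>x \<otimes> d\<close>. Since
        \<open>x1\<close> and \<open>x2\<close> differ, some \<open>x'\<close> other than
        \<open>x\<close> exists, and \<open>x \<otimes> d\<close> equals
        \<open>x' \<otimes> t x' x\<close> by the equation for \<open>t\<close>.\<close>
      obtain x' where x': "x' \<in> X" "x' \<noteq> x" using X by metis
      with * False t have "z = x' \<otimes> t x' x" by simp
      moreover have "t x' x \<in> T" using x' * by (auto simp: T_def)
      ultimately show ?thesis using x' unfolding mem_set_mult by blast
    qed (use * in \<open>auto simp: mem_set_mult\<close>)
    then show "z \<in> two_sided_gen H (X <#> T)" using subset_two_sided_gen[OF XT] by blast
  qed
  then have "two_sided_gen H (X <#> insert d T) \<subseteq> two_sided_gen H (X <#> T)"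
    using XT by (rule two_sided_gen_least)
  moreover have "X <#> T \<subseteq> two_sided_gen H (X <#> insert d T)"
    using subset_two_sided_gen[of "X <#> insert d T"] X T d
    by (auto simp: set_mult_closed set_mult_def)
  then have "two_sided_gen H (X <#> T) \<subseteq> two_sided_gen H (X <#> insert d T)"
    using X T d by (intro two_sided_gen_least) (auto simp: set_mult_closed)
  ultimately have "two_sided_gen H X <#> two_sided_gen H T
      = two_sided_gen H X <#> two_sided_gen H (insert d T)"
    using X T d by (simp add: two_sided_gen_mult)
  moreover have "two_sided_gen H T \<in> fin_gen_ideals H"
    "two_sided_gen H (insert d T) \<in> fin_gen_ideals H"
    unfolding fin_gen_ideals_def using T d by blast+
  ultimately have "two_sided_gen H T = two_sided_gen H (insert d T)"
    using lc by (simp add: left_cancellable_def ideal_semigroup_fin_simps)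
  then have "d \<in> two_sided_gen H T"
    using subset_two_sided_gen[of "insert d T"] T d by auto
  then obtain x y h where *: "x \<in> X" "y \<in> X" "x \<noteq> y" "h \<in> carrier H" "d = t x y \<otimes> h"
    unfolding mem_two_sided_gen[OF T(2)] by (auto simp: T_def)
  have xy: "x \<in> carrier H" "y \<in> carrier H" using * X by auto
  \<comment> \<open>Turning \<open>d \<otimes> h\<close> into \<open>h' \<otimes> d\<close> puts
    \<open>d\<close> on the right of both sides of the equation below, where it can be
    cancelled.\<close>
  obtain h' where h': "h' \<in> carrier H" "d \<otimes> h = h' \<otimes> d"
    using commute_right[OF d(1) \<open>h \<in> carrier H\<close>] .
  have txy: "t x y \<in> carrier H" "x \<otimes> t x y = y \<otimes> d"
    using t * by auto
  have "x \<otimes> d = x \<otimes> (t x y \<otimes> h)"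
    using *(5) by simp
  also have "\<dots> = y \<otimes> (d \<otimes> h)"
    using txy xy d *(4) by (simp flip: m_assoc)
  also have "\<dots> = y \<otimes> h' \<otimes> d"
    using h' xy d by (simp add: m_assoc)
  finally have "x = y \<otimes> h'"
    using xy h' d by (auto dest: r_cancel)
  then have "y divides x" using h' by (auto simp: factor_def)
  with * antichain show False by blast
qed

text \<open>A generating set of least cardinality is an antichain for divisibility, so by the
  preceding lemma it cannot have two distinct elements.\<close>

lemma left_cancellable_principal:
  assumes lc: "A \<in> left_cancellable (ideal_semigroup_fin H)"
  shows "A \<in> principal_ideals H"
proof -
  let ?P = "\<lambda>X. finite X \<and> X \<noteq> {} \<and> X \<subseteq> carrier H \<and> two_sided_gen H X = A"
  have "A \<in> fin_gen_ideals H"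
    using lc by (simp add: left_cancellable_def ideal_semigroup_fin_simps)
  then obtain X0 where "?P X0"
    unfolding fin_gen_ideals_def by blast
  from ex_has_least_nat[of ?P, OF this, of card]
  obtain X where X: "?P X" and min: "\<forall>Y. ?P Y \<longrightarrow> card X \<le> card Y"
    by (elim exE conjE) (rule that, intro conjI)
  have antichain: "x = y" if xy: "x \<in> X" "y \<in> X" "y divides x" for x y
  proof (rule ccontr)
    assume "x \<noteq> y"
    \<comment> \<open>As \<open>y\<close> divides \<open>x\<close> and remains in \<open>?Y\<close>,
      the generator \<open>x\<close> is redundant, against the minimality of
      \<open>card X\<close>.\<close>
    let ?Y = "X - {x}"
    have Y: "?Y \<subseteq> carrier H" "y \<in> ?Y" using X xy \<open>x \<noteq> y\<close> by auto
    then have "x \<in> two_sided_gen H ?Y"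
      using xy unfolding mem_two_sided_gen[OF Y(1)] factor_def by blast
    then have "X \<subseteq> two_sided_gen H ?Y"
      using subset_two_sided_gen[OF Y(1)] by blast
    then have "A \<subseteq> two_sided_gen H ?Y"
      using X Y two_sided_gen_least by blast
    moreover have "two_sided_gen H ?Y \<subseteq> A"
      using X two_sided_gen_least[of ?Y X] subset_two_sided_gen[of X] by auto
    ultimately have "?P ?Y" using X Y by blast
    then have "card X \<le> card ?Y" by (rule min[rule_format])
    moreover have "card ?Y < card X" using X xy by (intro psubset_card_mono) auto
    ultimately show False by simp
  qed
  obtain x where x: "x \<in> X" using X by blast
  have "X = {x}"
  proof (rule ccontr)
    assume "X \<noteq> {x}"
    with x obtain y where "y \<in> X" "x \<noteq> y" by blast
    then show False
      using antichain_not_left_cancellable[of X x y] antichain X x lc by blast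
  qed
  with X show ?thesis by (auto simp: principal_ideals_def)
qed

text \<open>Being principal thereby becomes a property of the multiplication of ideals
  alone.\<close>

lemma left_cancellable_eq_principal_ideals:
  "left_cancellable (ideal_semigroup_fin H) = principal_ideals H"
  using principal_left_cancellable left_cancellable_principal by blast

end

theorem theorem23:
  fixes H :: "('a, 'm) monoid_scheme" and K :: "('b, 'n) monoid_scheme"
  assumes "monoid_cancel H" and "duo_monoid H" and "archimedean_monoid H"
    and "monoid_cancel K" and "duo_monoid K" and "archimedean_monoid K"
  shows "(\<forall>f \<in> iso (ideal_semigroup_fin H) (ideal_semigroup_fin K).
            f \<in> iso (principal_semigroup H) (principal_semigroup K) \<and>
            f ` carrier (principal_semigroup H) = carrier (principal_semigroup K))
       \<and> (ideal_semigroup_fin H \<cong> ideal_semigroup_fin K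
            \<longrightarrow> reduced_quotient H \<cong> reduced_quotient K)"
proof -
  interpret H: cancel_duo_monoid H
    using assms by (simp add: cancel_duo_monoid_def)
  interpret K: cancel_duo_monoid K
    using assms by (simp add: cancel_duo_monoid_def)
  have principal: "f \<in> iso (principal_semigroup H) (principal_semigroup K)"
    "f ` carrier (principal_semigroup H) = carrier (principal_semigroup K)"
    if f: "f \<in> iso (ideal_semigroup_fin H) (ideal_semigroup_fin K)" for f
  proof -
    have sub: "principal_ideals H \<subseteq> fin_gen_ideals H"
      by (auto simp: principal_ideals_def fin_gen_ideals_def)
    \<comment> \<open>The image of the left cancellable elements is known on both sides, so
      \<open>f\<close> matches the principal ideals exactly; the restriction inherits injectivity
      and multiplicativity from \<open>f\<close>.\<close>
    have im: "f ` principal_ideals H = principal_ideals K"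
      using iso_image_left_cancellable[OF f H.ideal_semigroup_fin_closed]
      by (simp add: H.left_cancellable_eq_principal_ideals K.left_cancellable_eq_principal_ideals)
    then show "f ` carrier (principal_semigroup H) = carrier (principal_semigroup K)"
      by (simp add: H.principal_semigroup_simps K.principal_semigroup_simps)
    show "f \<in> iso (principal_semigroup H) (principal_semigroup K)"
      using f im sub
      by (auto simp: iso_def hom_def bij_betw_def H.principal_semigroup_simps
          K.principal_semigroup_simps H.ideal_semigroup_fin_simps K.ideal_semigroup_fin_simps
          subset_iff intro: inj_on_subset)
  qed
  have "reduced_quotient H \<cong> reduced_quotient K"
    if "ideal_semigroup_fin H \<cong> ideal_semigroup_fin K"
  proof -
    have "reduced_quotient H \<cong> principal_semigroup H"
      using H.principal_semigroup_iso_reduced_quotient H.principal_semigroup_closed by (rule is_iso_sym)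
    also have "\<dots> \<cong> principal_semigroup K"
      using that principal(1) unfolding is_iso_def by blast
    also have "\<dots> \<cong> reduced_quotient K"
      by (rule K.principal_semigroup_iso_reduced_quotient)
    finally show ?thesis .
  qed
  with principal show ?thesis by blast
qed

end
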